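(* Let $V$ be a real vector space, and let $\mathrm{Cvx}(V,\overline{\mathbb{R}})$ be the set of lower semicontinuous, convex functions $V\to\overline{\mathbb{R}}$, equipped with the $\overline{\mathbb{R}}$-metric $\mathrm{d}(f_1,f_2)=\sup_{x\in V}\{f_2(x)-f_1(x)\}$. Then $\mathrm{Cvx}(V,\overline{\mathbb{R}})$ has all products, coproducts, cotensors and tensors, and they are given as follows: for $f\in\mathrm{Cvx}(V,\overline{\mathbb{R}})$, any family $(f_i)_{i\in I}$ in $\mathrm{Cvx}(V,\overline{\mathbb{R}})$, $a\in\overline{\mathbb{R}}$ and $x\in V$, $$\Bigl(\prod_i f_i\Bigr)(x)=\sup_i f_i(x),\qquad (a\pitchfork f)(x)=f(x)-a,$$ $$\Bigl(\coprod_i f_i\Bigr)(x)=\bigl(\inf_i f_i\bigr)^{\star\star}(x),\qquad (a\odot f)(x)=f(x)+a,$$ where $\inf_i f_i$ denotes the pointwise infimum.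
   Context: $\overline{\mathbb{R}}=[-\infty,+\infty]$. Addition on $\overline{\mathbb{R}}$ extends that of $\mathbb{R}$ by $(+\infty)+y=y+(+\infty)=+\infty$ for all $y\in\overline{\mathbb{R}}$ (including $y=-\infty$) and $(-\infty)+y=y+(-\infty)=-\infty$ for all $y<+\infty$. Subtraction on $\overline{\mathbb{R}}$ is defined by $c-b:=\inf\{a\in\overline{\mathbb{R}}\mid a+b\ge c\}$. Thus it is the usual subtraction on finite values; $c-(+\infty)=-\infty$ for every $c$; $(-\infty)-b=-\infty$ for every $b$; $c-(-\infty)=+\infty$ for every $c>-\infty$; $(+\infty)-b=+\infty$ for every $b<+\infty$. In particular $(+\infty)-(+\infty)=-\infty=(-\infty)-(-\infty)$. Suprema and infima of subsets are taken in $\overline{\mathbb{R}}$ (so $\sup\emptyset=-\infty$, $\inf\emptyset=+\infty$). Let $V^{\#}$ be the linear dual of $V$ and $\langle x,k\rangle:=k(x)$. For $f\colon V\to\overline{\mathbb{R}}$ and $g\colon V^{\#}\to\overline{\mathbb{R}}$ put $$f^{\star}(k):=\sup_{x\in V}\{\langle x,k\rangle-f(x)\},\qquad g^{\star}(x):=\sup_{k\in V^{\#}}\{\langle x,k\rangle-g(k)\},$$ and $f^{\star\star}:=(f^{\star})^{\star}$. The lower semicontinuous, convex functions on $V$ are by convention the functions $f\colon V\to\overline{\mathbb{R}}$ with $f=f^{\star\star}$, equivalently the pointwise suprema of (possibly empty) families of functions $x\mapsto\langle x,k\rangle+a$ with $k\in V^{\#}$, $a\in\mathbb{R}$. Let $X$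 be a set with a function $\mathrm{d}\colon X\times X\to\overline{\mathbb{R}}$ satisfying $\mathrm{d}(x,x')+\mathrm{d}(x',x'')\ge\mathrm{d}(x,x'')$ and $0\ge\mathrm{d}(x,x)$ (an $\overline{\mathbb{R}}$-space), and suppose it is skeletal, i.e. $0\ge\mathrm{d}(x,x')$ and $0\ge\mathrm{d}(x',x)$ imply $x=x'$. The following elements of $X$ are unique if they exist. The product $\prod_i x_i$ of a family is the element with $\mathrm{d}(y,\prod_i x_i)=\sup_i\mathrm{d}(y,x_i)$ for all $y\in X$. The coproduct $\coprod_i x_i$ is the element with $\mathrm{d}(\coprod_i x_i,y)=\sup_i\mathrm{d}(x_i,y)$ for all $y$. For $a\in\overline{\mathbb{R}}$, the cotensor $a\pitchfork x$ is the element with $\mathrm{d}(y,a\pitchfork x)=\mathrm{d}(y,x)-a$ for all $y$. The tensor $a\odot x$ is the element with $\mathrm{d}(a\odot x,y)=\mathrm{d}(x,y)-a$ for all $y$.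
   Formalization: The formula (a⊙f)(x)=f(x)+a fails when a=-∞, f(x)=+∞ and f is not identically +∞ (e.g. f=0 at 0, +∞ elsewhere on ℝ); it is proved in all other cases, and in every case the tensor exists and equals (f+a)**. *)

theory Defs
  imports Complex_Main "HOL-Library.Extended_Real"
begin

text \<open>
  Addition of \<^typ>\<open>ereal\<close> already satisfies \<open>\<infinity> + y = y + \<infinity> = \<infinity>\<close> for all \<open>y\<close>, including \<open>-\<infinity>\<close>.
  The library subtraction is \<open>c + (- b)\<close>, which gives \<open>\<infinity> - \<infinity> = -\<infinity> - (-\<infinity>) = \<infinity>\<close>; the residual
  of addition defined here gives \<open>-\<infinity>\<close> in both cases.
\<close>

definition rdiff :: "ereal \<Rightarrow> ereal \<Rightarrow> ereal"  (infixl "\<ominus>" 65)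
  where "c \<ominus> b = Inf {a. a + b \<ge> c}"


definition rbar_space :: "'x set \<Rightarrow> ('x \<Rightarrow> 'x \<Rightarrow> ereal) \<Rightarrow> bool"
  where "rbar_space X d \<longleftrightarrow>
    (\<forall>x\<in>X. \<forall>x'\<in>X. \<forall>x''\<in>X. d x x' + d x' x'' \<ge> d x x'') \<and> (\<forall>x\<in>X. 0 \<ge> d x x)"

definition skeletal :: "'x set \<Rightarrow> ('x \<Rightarrow> 'x \<Rightarrow> ereal) \<Rightarrow> bool"
  where "skeletal X d \<longleftrightarrow> (\<forall>x\<in>X. \<forall>x'\<in>X. 0 \<ge> d x x' \<and> 0 \<ge> d x' x \<longrightarrow> x = x')"

definition is_product :: "'x set \<Rightarrow> ('x \<Rightarrow> 'x \<Rightarrow> ereal) \<Rightarrow> 'i set \<Rightarrow> ('i \<Rightarrow> 'x) \<Rightarrow> 'x \<Rightarrow> bool"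
  where "is_product X d I xs p \<longleftrightarrow> p \<in> X \<and> (\<forall>y\<in>X. d y p = (SUP i\<in>I. d y (xs i)))"

definition is_coproduct :: "'x set \<Rightarrow> ('x \<Rightarrow> 'x \<Rightarrow> ereal) \<Rightarrow> 'i set \<Rightarrow> ('i \<Rightarrow> 'x) \<Rightarrow> 'x \<Rightarrow> bool"
  where "is_coproduct X d I xs p \<longleftrightarrow> p \<in> X \<and> (\<forall>y\<in>X. d p y = (SUP i\<in>I. d (xs i) y))"

definition is_cotensor :: "'x set \<Rightarrow> ('x \<Rightarrow> 'x \<Rightarrow> ereal) \<Rightarrow> ereal \<Rightarrow> 'x \<Rightarrow> 'x \<Rightarrow> bool"
  where "is_cotensor X d a x p \<longleftrightarrow> p \<in> X \<and> (\<forall>y\<in>X. d y p = d y x \<ominus> a)"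

definition is_tensor :: "'x set \<Rightarrow> ('x \<Rightarrow> 'x \<Rightarrow> ereal) \<Rightarrow> ereal \<Rightarrow> 'x \<Rightarrow> 'x \<Rightarrow> bool"
  where "is_tensor X d a x p \<longleftrightarrow> p \<in> X \<and> (\<forall>y\<in>X. d p y = d x y \<ominus> a)"

definition rproduct :: "'x set \<Rightarrow> ('x \<Rightarrow> 'x \<Rightarrow> ereal) \<Rightarrow> 'i set \<Rightarrow> ('i \<Rightarrow> 'x) \<Rightarrow> 'x"
  where "rproduct X d I xs = (THE p. is_product X d I xs p)"

definition rcoproduct :: "'x set \<Rightarrow> ('x \<Rightarrow> 'x \<Rightarrow> ereal) \<Rightarrow> 'i set \<Rightarrow> ('i \<Rightarrow> 'x) \<Rightarrow> 'x"
  where "rcoproduct X d I xs = (THE p. is_coproduct X d I xs p)"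

definition cotensor :: "'x set \<Rightarrow> ('x \<Rightarrow> 'x \<Rightarrow> ereal) \<Rightarrow> ereal \<Rightarrow> 'x \<Rightarrow> 'x"
  where "cotensor X d a x = (THE p. is_cotensor X d a x p)"

definition tensor :: "'x set \<Rightarrow> ('x \<Rightarrow> 'x \<Rightarrow> ereal) \<Rightarrow> ereal \<Rightarrow> 'x \<Rightarrow> 'x"
  where "tensor X d a x = (THE p. is_tensor X d a x p)"


text \<open>
  The algebraic dual of \<open>'v\<close> is the set of all linear \<open>k :: 'v \<Rightarrow> real\<close>, with pairing \<open>k x\<close>.  A function
  on the dual is a function on all of \<open>'v \<Rightarrow> real\<close> whose values off the dual are never used.
\<close>

definition lin_dual :: "('v::real_vector \<Rightarrow> real) set"
  where "lin_dual = {k. linear k}"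

definition conjugate :: "('v::real_vector \<Rightarrow> ereal) \<Rightarrow> ('v \<Rightarrow> real) \<Rightarrow> ereal"
  where "conjugate f k = (SUP x. ereal (k x) \<ominus> f x)"

definition dual_conjugate :: "(('v::real_vector \<Rightarrow> real) \<Rightarrow> ereal) \<Rightarrow> 'v \<Rightarrow> ereal"
  where "dual_conjugate g x = (SUP k\<in>lin_dual. ereal (k x) \<ominus> g k)"

definition biconjugate :: "('v::real_vector \<Rightarrow> ereal) \<Rightarrow> 'v \<Rightarrow> ereal"
  where "biconjugate f = dual_conjugate (conjugate f)"

definition Cvx :: "('v::real_vector \<Rightarrow> ereal) set"
  where "Cvx = {f. f = biconjugate f}"

definition fun_dist :: "('v::real_vector \<Rightarrow> ereal) \<Rightarrow> ('v \<Rightarrow> ereal) \<Rightarrow> ereal"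
  where "fun_dist f1 f2 = (SUP x. f2 x \<ominus> f1 x)"


text \<open>
  For \<open>a = -\<infinity>\<close> the pointwise formula \<open>f x + a\<close> need not describe the tensor: if \<open>f\<close> takes the value
  \<open>\<infinity>\<close> at some but not all points, then \<open>\<lambda>x. f x + -\<infinity>\<close> takes both values \<open>-\<infinity>\<close> and \<open>\<infinity>\<close> and so is
  not in \<^const>\<open>Cvx\<close>.  The tensor is then its biconjugate, the constant \<open>-\<infinity>\<close>.
\<close>

lemma rdiff_le_iff: "c \<ominus> b \<le> a \<longleftrightarrow> c \<le> a + b"
proof
  assume *: "c \<le> a + b"
  then show "c \<ominus> b \<le> a" unfolding rdiff_def by (intro Inf_lower) simp
next
  assume *: "c \<ominus> b \<le> a"
  show "c \<le> a + b"
  proof (cases "b = \<infinity> \<or> c = -\<infinity>")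
    case True then show ?thesis by auto
  next
    case False
    then have nb: "b \<noteq> \<infinity>" and nc: "c \<noteq> -\<infinity>" by auto
    show ?thesis
    proof (cases b)
      case (real r)
      have "{a. a + b \<ge> c} = {c - b..}" unfolding real by (auto simp: ereal_minus_le)
      then have "c \<ominus> b = c - b" by (simp add: rdiff_def)
      with * show ?thesis unfolding real by (simp add: ereal_minus_le)
    next
      case MInf
      have "{a. a + b \<ge> c} = {\<infinity>}" unfolding MInf
      proof safe
        fix x :: ereal assume "c \<le> x + -\<infinity>" then show "x = \<infinity>" using nc by (cases x) auto
      qed auto
      then have "c \<ominus> b = \<infinity>" by (simp add: rdiff_def)
      with * show ?thesis by simp
    qed (use nb in auto)
  qed
qed

lemma rdiff_simps:
  "c \<ominus> \<infinity> = -\<infinity>" "(-\<infinity>) \<ominus> b = -\<infinity>" "c \<noteq> -\<infinity> \<Longrightarrow> c \<ominus> (-\<infinity>) = \<infinity>"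
  "c \<ominus> ereal s = c - ereal s"
proof -
  show "c \<ominus> \<infinity> = -\<infinity>" using rdiff_le_iff[of c \<infinity> "-\<infinity>"] by simp
  show "(-\<infinity>) \<ominus> b = -\<infinity>" using rdiff_le_iff[of "-\<infinity>" b "-\<infinity>"] by simp
  show "c \<ominus> (-\<infinity>) = \<infinity>" if "c \<noteq> -\<infinity>"
    using rdiff_le_iff[of c "-\<infinity>" "c \<ominus> (-\<infinity>)"] that by (cases "c \<ominus> (-\<infinity>)") auto
  show "c \<ominus> ereal s = c - ereal s"
  proof (rule antisym)
    show "c \<ominus> ereal s \<le> c - ereal s" unfolding rdiff_le_iff by (cases c) simp_all
    have "c \<le> (c \<ominus> ereal s) + ereal s" using rdiff_le_iff by blast
    then show "c - ereal s \<le> c \<ominus> ereal s" by (simp add: ereal_minus_le)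
  qed
qed

lemma pointwise_tensor_not_Cvx:
  defines "f \<equiv> \<lambda>x::real. if x = 0 then 0 else (\<infinity>::ereal)"
  shows "f \<in> Cvx" and "(\<lambda>x. f x + -\<infinity>) \<notin> Cvx"
proof -
  have lin: "(\<lambda>x. c * x) \<in> lin_dual" for c :: real
    by (simp add: lin_dual_def linear_times)
  have k0: "k 0 = 0" if "k \<in> lin_dual" for k :: "real \<Rightarrow> real"
    using that by (simp add: lin_dual_def linear_0)
  have conj: "conjugate f k = 0" if "k \<in> lin_dual" for k
    unfolding conjugate_def
  proof (rule antisym)
    show "(SUP x. ereal (k x) \<ominus> f x) \<le> 0"
      by (rule SUP_least) (use k0[OF that] in \<open>auto simp: f_def rdiff_le_iff zero_ereal_def\<close>)
    have "ereal (k 0) \<ominus> f 0 = 0"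
      using k0[OF that] by (simp add: f_def zero_ereal_def rdiff_simps)
    then show "0 \<le> (SUP x. ereal (k x) \<ominus> f x)" by (intro SUP_upper2[of 0]) simp_all
  qed
  have "biconjugate f x = f x" for x
  proof -
    have e: "biconjugate f x = (SUP k\<in>lin_dual. ereal (k x))"
      unfolding biconjugate_def dual_conjugate_def
      by (rule SUP_cong) (simp_all add: conj zero_ereal_def rdiff_simps)
    show ?thesis
    proof (cases "x = 0")
      case True
      have "(SUP k\<in>(lin_dual::(real\<Rightarrow>real) set). ereal (k x)) = (SUP k\<in>(lin_dual::(real\<Rightarrow>real) set). 0)"
        by (rule SUP_cong) (simp_all add: True k0 zero_ereal_def)
      also have "\<dots> = 0" using lin by (intro SUP_const) blast
      finally show ?thesis using e True by (simp add: f_def)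
    next
      case False
      have "ereal r \<le> biconjugate f x" for r
        unfolding e by (rule SUP_upper2[OF lin[of "r / x"]]) (use False in simp)
      then have "biconjugate f x = \<infinity>" by (rule ereal_top)
      then show ?thesis using False by (simp add: f_def)
    qed
  qed
  then have "biconjugate f = f" by (rule ext)
  then show "f \<in> Cvx" by (simp add: Cvx_def)
  define h where "h = (\<lambda>x. f x + -\<infinity>)"
  have h0: "h 0 = -\<infinity>" and h1: "h 1 = \<infinity>" by (auto simp: h_def f_def)
  have "conjugate h k = \<infinity>" for k
  proof -
    have "ereal (k 0) \<ominus> h 0 \<le> conjugate h k" unfolding conjugate_def by (rule SUP_upper) simp
    then show ?thesis by (simp add: h0 rdiff_simps)
  qed
  then have "biconjugate h 1 = (SUP k\<in>(lin_dual::(real\<Rightarrow>real) set). -\<infinity>)"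
    by (simp add: biconjugate_def dual_conjugate_def rdiff_simps)
  also have "\<dots> = -\<infinity>" using lin by (intro SUP_const) blast
  finally have "biconjugate h 1 \<noteq> h 1" using h1 by simp
  then have "h \<noteq> biconjugate h" by metis
  then show "(\<lambda>x. f x + -\<infinity>) \<notin> Cvx" by (simp add: Cvx_def h_def)
qed

end

theory Submission
  imports Defs
begin

text \<open>
  Everything is a consequence of the residuation \<open>c \<ominus> b \<le> a \<longleftrightarrow> c \<le> a + b\<close>.  It turns the
  distance into \<open>d(f, g) \<le> c \<longleftrightarrow> g \<le> c + f\<close>, and it makes conjugation an enriched Galois connection:
  \<open>g \<le> c + f\<close> implies \<open>f\<^sup>\<star> \<le> c + g\<^sup>\<star>\<close>, hence \<open>g\<^sup>\<star>\<^sup>\<star> \<le> c + f\<^sup>\<star>\<^sup>\<star>\<close>.  So the biconjugate is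
  an enriched reflection onto \<^const>\<open>Cvx\<close>: limits are computed pointwise, and colimits are the
  biconjugates of the pointwise ones.
\<close>

section \<open>Residuation, and uniqueness in skeletal spaces\<close>

lemma le_INF_add_iff:
  fixes c b :: ereal
  shows "c \<le> b + (INF i\<in>I. u i) \<longleftrightarrow> (\<forall>i\<in>I. c \<le> b + u i)"
  \<comment> \<open>Both sides say that \<open>c \<ominus> b\<close> is a lower bound of the
    \<open>u i\<close>. This includes the empty family, where
    \<open>b + \<infinity> = \<infinity>\<close> even for \<open>b = -\<infinity>\<close>.\<close>
  by (metis add.commute le_INF_iff rdiff_le_iff)

text \<open>Universal properties are checked by comparing upper bounds, because suprema,
  \<open>\<ominus>\<close> and \<open>fun_dist\<close> all unfold on the left of an
  inequality.\<close>

lemma ereal_eqI_le: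
  fixes a b :: ereal
  assumes "\<And>c. a \<le> c \<longleftrightarrow> b \<le> c"
  shows "a = b"
  using assms by (meson antisym order_refl)

text \<open>Yoneda argument: taking \<open>y = p\<close> and \<open>y = q\<close> turns the
  self-distances, which are at most 0, into the distances between \<open>p\<close> and
  \<open>q\<close> in both directions.\<close>

lemma skeletal_eqI_into:
  assumes "rbar_space X d" "skeletal X d" "p \<in> X" "q \<in> X" "\<And>y. y \<in> X \<Longrightarrow> d y p = d y q"
  shows "p = q"
  using assms unfolding rbar_space_def skeletal_def by metis

lemma skeletal_eqI_from:
  assumes "rbar_space X d" "skeletal X d" "p \<in> X" "q \<in> X" "\<And>y. y \<in> X \<Longrightarrow> d p y = d q y"
  shows "p = q"
  using assms unfolding rbar_space_def skeletal_def by metis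

lemma is_product_unique:
  assumes "rbar_space X d" "skeletal X d" "is_product X d I xs p" "is_product X d I xs q"
  shows "q = p"
  using assms by (intro skeletal_eqI_into[of X d]) (auto simp: is_product_def)

lemma is_coproduct_unique:
  assumes "rbar_space X d" "skeletal X d" "is_coproduct X d I xs p" "is_coproduct X d I xs q"
  shows "q = p"
  using assms by (intro skeletal_eqI_from[of X d]) (auto simp: is_coproduct_def)

lemma is_cotensor_unique:
  assumes "rbar_space X d" "skeletal X d" "is_cotensor X d a x p" "is_cotensor X d a x q"
  shows "q = p"
  using assms by (intro skeletal_eqI_into[of X d]) (auto simp: is_cotensor_def)

lemma is_tensor_unique:
  assumes "rbar_space X d" "skeletal X d" "is_tensor X d a x p" "is_tensor X d a x q"
  shows "q = p"
  using assms by (intro skeletal_eqI_from[of X d]) (auto simp: is_tensor_def)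

section \<open>The distance between functions\<close>

lemma fun_dist_le_iff: "fun_dist f g \<le> c \<longleftrightarrow> (\<forall>x. g x \<le> c + f x)"
  by (simp add: fun_dist_def SUP_le_iff rdiff_le_iff)

lemma le_fun_dist_add: "g x \<le> fun_dist f g + f x"
  \<comment> \<open>The equivalence is read at \<open>c = fun_dist f g\<close>. Both Fenchel-Young
    inequalities below arise in the same way.\<close>
  using fun_dist_le_iff by blast

lemma rbar_space_fun_dist: "rbar_space X fun_dist"
proof -
  have "h x \<le> fun_dist f g + fun_dist g h + f x" for f g h :: "'a \<Rightarrow> ereal" and x
  proof -
    have "h x \<le> fun_dist g h + g x" by (rule le_fun_dist_add)
    also have "\<dots> \<le> fun_dist g h + (fun_dist f g + f x)"
      by (intro add_left_mono le_fun_dist_add)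
    finally show ?thesis by (simp add: ac_simps)
  qed
  then show ?thesis by (simp add: rbar_space_def fun_dist_le_iff)
qed

lemma skeletal_fun_dist: "skeletal X fun_dist"
  by (auto simp: skeletal_def fun_dist_le_iff intro!: ext antisym)

section \<open>Conjugation and closure properties of \<open>Cvx\<close>\<close>

lemma conjugate_le_iff: "conjugate f k \<le> c \<longleftrightarrow> (\<forall>x. ereal (k x) \<le> c + f x)"
  by (simp add: conjugate_def SUP_le_iff rdiff_le_iff)

lemma dual_conjugate_le_iff:
  "dual_conjugate g x \<le> c \<longleftrightarrow> (\<forall>k\<in>lin_dual. ereal (k x) \<le> c + g k)"
  by (simp add: dual_conjugate_def SUP_le_iff rdiff_le_iff)

lemma fenchel_young: "ereal (k x) \<le> conjugate f k + f x"
  using conjugate_le_iff by blast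

lemma dual_fenchel_young: "k \<in> lin_dual \<Longrightarrow> ereal (k x) \<le> dual_conjugate g x + g k"
  using dual_conjugate_le_iff by blast

lemma conjugate_le_add:
  assumes "\<And>x. g x \<le> c + f x"
  shows "conjugate f k \<le> c + conjugate g k"
  unfolding conjugate_le_iff
proof
  fix x
  have "ereal (k x) \<le> conjugate g k + g x" by (rule fenchel_young)
  also have "\<dots> \<le> conjugate g k + (c + f x)" by (intro add_left_mono assms)
  finally show "ereal (k x) \<le> c + conjugate g k + f x" by (simp add: ac_simps)
qed

lemma dual_conjugate_le_add:
  assumes "\<And>k. k \<in> lin_dual \<Longrightarrow> g k \<le> c + f k"
  shows "dual_conjugate f x \<le> c + dual_conjugate g x"
  unfolding dual_conjugate_le_iff
proof
  fix k :: "'a \<Rightarrow> real"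
  assume k: "k \<in> lin_dual"
  then have "ereal (k x) \<le> dual_conjugate g x + g k" by (rule dual_fenchel_young)
  also have "\<dots> \<le> dual_conjugate g x + (c + f k)" by (intro add_left_mono assms k)
  finally show "ereal (k x) \<le> c + dual_conjugate g x + f k" by (simp add: ac_simps)
qed

lemma biconjugate_le_add:
  assumes "\<And>x. g x \<le> c + f x"
  shows "biconjugate g x \<le> c + biconjugate f x"
  unfolding biconjugate_def by (intro dual_conjugate_le_add conjugate_le_add assms)

lemma biconjugate_mono:
  assumes "\<And>x. g x \<le> f x"
  shows "biconjugate g x \<le> biconjugate f x"
  using biconjugate_le_add[of g 0 f] assms by simp

lemma biconjugate_le: "biconjugate f x \<le> f x"
  unfolding biconjugate_def dual_conjugate_le_iff
  using fenchel_young by (metis add.commute)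

lemma CvxI: "(\<And>x. f x \<le> biconjugate f x) \<Longrightarrow> f \<in> Cvx"
  by (auto simp: Cvx_def intro!: ext antisym biconjugate_le)

lemma Cvx_biconjugate_eq: "f \<in> Cvx \<Longrightarrow> biconjugate f = f"
  by (simp add: Cvx_def)

text \<open>Triangle identity of the Galois connection: dual Fenchel-Young bounds the conjugate of
  \<open>dual_conjugate g\<close> by \<open>g\<close> on \<open>lin_dual\<close>, and conjugating
  once more, with shift 0, reverses this bound.\<close>

lemma dual_conjugate_in_Cvx: "dual_conjugate g \<in> Cvx"
proof (rule CvxI)
  fix x
  have "conjugate (dual_conjugate g) k \<le> 0 + g k" if "k \<in> lin_dual" for k
    unfolding conjugate_le_iff using dual_fenchel_young[OF that] by (simp add: add.commute)
  then have "dual_conjugate g x \<le> 0 + dual_conjugate (conjugate (dual_conjugate g)) x"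
    by (rule dual_conjugate_le_add)
  then show "dual_conjugate g x \<le> biconjugate (dual_conjugate g) x"
    by (simp add: biconjugate_def)
qed

lemma biconjugate_in_Cvx: "biconjugate f \<in> Cvx"
  unfolding biconjugate_def by (rule dual_conjugate_in_Cvx)

text \<open>This is the reflection property. A bound \<open>h x \<le> c + f x\<close> survives
  biconjugation, which fixes \<open>h\<close>; conversely \<open>biconjugate f\<close> lies below
  \<open>f\<close>.\<close>

lemma fun_dist_biconjugate:
  assumes "h \<in> Cvx"
  shows "fun_dist (biconjugate f) h = fun_dist f h"
proof (rule antisym)
  show "fun_dist (biconjugate f) h \<le> fun_dist f h"
    using biconjugate_le_add[of h "fun_dist f h" f]
    by (simp add: fun_dist_le_iff le_fun_dist_add Cvx_biconjugate_eq[OF assms])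
  show "fun_dist f h \<le> fun_dist (biconjugate f) h"
    unfolding fun_dist_le_iff
    by (meson add_left_mono biconjugate_le le_fun_dist_add order_trans)
qed

text \<open>Each member equals its own biconjugate, which by monotonicity lies below that of the
  supremum. For empty \<open>I\<close> the function is the constant
  \<open>-\<infinity>\<close>.\<close>

lemma Cvx_SUP:
  assumes "\<And>i. i \<in> I \<Longrightarrow> fs i \<in> Cvx"
  shows "(\<lambda>x. SUP i\<in>I. fs i x) \<in> Cvx"
proof (intro CvxI SUP_least)
  fix x i assume i: "i \<in> I"
  then have "biconjugate (fs i) x \<le> biconjugate (\<lambda>x. SUP i\<in>I. fs i x) x"
    by (intro biconjugate_mono SUP_upper)
  then show "fs i x \<le> biconjugate (\<lambda>x. SUP i\<in>I. fs i x) x"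
    by (simp add: Cvx_biconjugate_eq assms i)
qed

text \<open>Residuation moves \<open>a\<close> to the other side, where biconjugation respects
  adding a constant; infinite \<open>a\<close> is thus treated like finite \<open>a\<close>.\<close>

lemma Cvx_rdiff:
  assumes "f \<in> Cvx"
  shows "(\<lambda>x. f x \<ominus> a) \<in> Cvx"
proof (rule CvxI)
  fix x
  have "f x \<le> a + (f x \<ominus> a)" for x
    by (metis add.commute order_refl rdiff_le_iff)
  then have "biconjugate f x \<le> a + biconjugate (\<lambda>x. f x \<ominus> a) x"
    by (rule biconjugate_le_add)
  then show "f x \<ominus> a \<le> biconjugate (\<lambda>x. f x \<ominus> a) x"
    by (simp add: rdiff_le_iff add.commute Cvx_biconjugate_eq[OF assms])
qed

lemma Cvx_const_PInfty: "(\<lambda>x. \<infinity>) \<in> Cvx"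
proof -
  have "conjugate (\<lambda>x. \<infinity>) k = -\<infinity>" for k :: "'a \<Rightarrow> real"
    by (simp add: conjugate_def rdiff_simps)
  \<comment> \<open>Any functional would do as witness: against a conjugate equal to
    \<open>-\<infinity>\<close> it contributes \<open>\<infinity>\<close> to the supremum.\<close>
  moreover have "(\<lambda>x. 0) \<in> (lin_dual :: ('a \<Rightarrow> real) set)"
    by (simp add: lin_dual_def linear_zero)
  ultimately show ?thesis
    by (intro CvxI, unfold biconjugate_def dual_conjugate_def, intro SUP_upper2[of "\<lambda>x. 0"]) (simp_all add: rdiff_simps)
qed

section \<open>The four universal constructions in \<open>Cvx\<close>\<close>

lemma is_product_Cvx:
  assumes "\<And>i. i \<in> I \<Longrightarrow> fs i \<in> Cvx"
  shows "is_product Cvx fun_dist I fs (\<lambda>x. SUP i\<in>I. fs i x)"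
  unfolding is_product_def
proof (intro conjI ballI ereal_eqI_le)
  show "(\<lambda>x. SUP i\<in>I. fs i x) \<in> Cvx" by (intro Cvx_SUP assms)
qed (auto simp: fun_dist_le_iff SUP_le_iff)

text \<open>By the reflection property, distances from the biconjugate into \<open>Cvx\<close> are
  those from the pointwise infimum.\<close>

lemma is_coproduct_Cvx:
  fixes fs :: "'i \<Rightarrow> 'b::real_vector \<Rightarrow> ereal"
  shows "is_coproduct Cvx fun_dist I fs (biconjugate (\<lambda>x. INF i\<in>I. fs i x))"
  unfolding is_coproduct_def
proof (intro conjI ballI ereal_eqI_le biconjugate_in_Cvx)
  fix y :: "'b \<Rightarrow> ereal" and c
  assume "y \<in> Cvx"
  then show "fun_dist (biconjugate (\<lambda>x. INF i\<in>I. fs i x)) y \<le> c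
      \<longleftrightarrow> (SUP i\<in>I. fun_dist (fs i) y) \<le> c"
    by (auto simp: fun_dist_biconjugate fun_dist_le_iff le_INF_add_iff SUP_le_iff)
qed

lemma is_cotensor_Cvx:
  assumes "f \<in> Cvx"
  shows "is_cotensor Cvx fun_dist a f (\<lambda>x. f x \<ominus> a)"
  unfolding is_cotensor_def
proof (intro conjI ballI ereal_eqI_le Cvx_rdiff assms)
  show "fun_dist y (\<lambda>x. f x \<ominus> a) \<le> c \<longleftrightarrow> fun_dist y f \<ominus> a \<le> c" for y c
    by (simp add: fun_dist_le_iff rdiff_le_iff ac_simps)
qed

lemma is_tensor_Cvx: "is_tensor Cvx fun_dist a f (biconjugate (\<lambda>x. f x + a))"
  unfolding is_tensor_def
proof (intro conjI ballI ereal_eqI_le biconjugate_in_Cvx)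
  fix y c
  assume "y \<in> (Cvx :: ('a \<Rightarrow> ereal) set)"
  then show "fun_dist (biconjugate (\<lambda>x. f x + a)) y \<le> c \<longleftrightarrow> fun_dist f y \<ominus> a \<le> c"
    by (simp add: fun_dist_biconjugate fun_dist_le_iff rdiff_le_iff ac_simps)
qed

text \<open>The excluded case is \<open>a = -\<infinity>\<close> and
  \<open>f x = \<infinity>\<close> with \<open>f\<close> not constantly \<open>\<infinity>\<close>.
  There the shifted function takes the value \<open>-\<infinity>\<close> somewhere, so its
  biconjugate is constantly \<open>-\<infinity>\<close>, whereas
  \<open>f x + a = \<infinity>\<close>.\<close>

lemma biconjugate_add_const:
  assumes f: "f \<in> Cvx" and a: "a \<noteq> -\<infinity> \<or> f x \<noteq> \<infinity> \<or> (\<forall>y. f y = \<infinity>)"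
  shows "biconjugate (\<lambda>z. f z + a) x = f x + a"
proof (cases a)
  case (real r)
  \<comment> \<open>Adding a finite \<open>r\<close> is subtracting \<open>- r\<close>, so closure
    under \<open>\<ominus>\<close> applies.\<close>
  have "(\<lambda>z. f z \<ominus> ereal (- r)) \<in> Cvx" by (rule Cvx_rdiff[OF f])
  moreover have "(\<lambda>z. f z \<ominus> ereal (- r)) = (\<lambda>z. f z + a)"
    by (simp add: rdiff_simps real minus_ereal_def)
  ultimately show ?thesis by (simp add: Cvx_biconjugate_eq)
next
  case PInf
  then show ?thesis by (simp add: Cvx_biconjugate_eq[OF Cvx_const_PInfty])
next
  case MInf
  show ?thesis
  proof (cases "f x = \<infinity>")
    case True
    with a MInf show ?thesis by (simp add: Cvx_biconjugate_eq[OF Cvx_const_PInfty])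
  next
    case False
    then have "f x + a = -\<infinity>" by (simp add: MInf)
    \<comment> \<open>The pointwise value is already the least element, and the biconjugate lies
      below it.\<close>
    then show ?thesis
      using biconjugate_le[of "\<lambda>z. f z + a" x] by (metis ereal_infty_less_eq(2))
  qed
qed

text \<open>Unique existence accompanies each value because the operations are \<open>THE\<close>
  terms. The tensor is given by a biconjugate in general, and by the pointwise sum wherever the side
  condition holds.\<close>

theorem theorem7:
  shows "rbar_space (Cvx :: ('v::real_vector \<Rightarrow> ereal) set) fun_dist
    \<and> skeletal (Cvx :: ('v \<Rightarrow> ereal) set) fun_dist
    \<and> (\<forall>(I :: 'i set) (fs :: 'i \<Rightarrow> 'v \<Rightarrow> ereal). (\<forall>i\<in>I. fs i \<in> Cvx) \<longrightarrow>
          (\<exists>!p. is_product Cvx fun_dist I fs p)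
        \<and> (\<forall>x. rproduct Cvx fun_dist I fs x = (SUP i\<in>I. fs i x))
        \<and> (\<exists>!p. is_coproduct Cvx fun_dist I fs p)
        \<and> (\<forall>x. rcoproduct Cvx fun_dist I fs x = biconjugate (\<lambda>z. INF i\<in>I. fs i z) x))
    \<and> (\<forall>(f :: 'v \<Rightarrow> ereal) a. f \<in> Cvx \<longrightarrow>
          (\<exists>!p. is_cotensor Cvx fun_dist a f p)
        \<and> (\<forall>x. cotensor Cvx fun_dist a f x = f x \<ominus> a)
        \<and> (\<exists>!p. is_tensor Cvx fun_dist a f p)
        \<and> (\<forall>x. tensor Cvx fun_dist a f x = biconjugate (\<lambda>z. f z + a) x)
        \<and> (\<forall>x. a \<noteq> -\<infinity> \<or> f x \<noteq> \<infinity> \<or> (\<forall>y. f y = \<infinity>) \<longrightarrow>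
              tensor Cvx fun_dist a f x = f x + a))"
proof (intro conjI allI impI)
  note uniq = rbar_space_fun_dist skeletal_fun_dist
  show "rbar_space (Cvx :: ('v \<Rightarrow> ereal) set) fun_dist" by (rule rbar_space_fun_dist)
  show "skeletal (Cvx :: ('v \<Rightarrow> ereal) set) fun_dist" by (rule skeletal_fun_dist)
  fix I :: "'i set" and fs :: "'i \<Rightarrow> 'v \<Rightarrow> ereal" and x
  assume "\<forall>i\<in>I. fs i \<in> Cvx"
  then have prod: "is_product Cvx fun_dist I fs (\<lambda>x. SUP i\<in>I. fs i x)"
    by (intro is_product_Cvx) blast
  show "\<exists>!p. is_product Cvx fun_dist I fs p"
    using prod is_product_unique[OF uniq prod] by (rule ex1I)
  have "rproduct Cvx fun_dist I fs = (\<lambda>x. SUP i\<in>I. fs i x)"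
    unfolding rproduct_def using prod is_product_unique[OF uniq prod] by (rule the_equality)
  then show "rproduct Cvx fun_dist I fs x = (SUP i\<in>I. fs i x)"
    by simp
  note coprod = is_coproduct_Cvx[of I fs]
  show "\<exists>!p. is_coproduct Cvx fun_dist I fs p"
    using coprod is_coproduct_unique[OF uniq coprod] by (rule ex1I)
  have "rcoproduct Cvx fun_dist I fs = biconjugate (\<lambda>z. INF i\<in>I. fs i z)"
    unfolding rcoproduct_def using coprod is_coproduct_unique[OF uniq coprod] by (rule the_equality)
  then show "rcoproduct Cvx fun_dist I fs x = biconjugate (\<lambda>z. INF i\<in>I. fs i z) x"
    by simp
next
  note uniq = rbar_space_fun_dist skeletal_fun_dist
  fix f :: "'v \<Rightarrow> ereal" and a x
  assume f: "f \<in> Cvx"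
  note cot = is_cotensor_Cvx[OF f, of a]
  show "\<exists>!p. is_cotensor Cvx fun_dist a f p"
    using cot is_cotensor_unique[OF uniq cot] by (rule ex1I)
  have "cotensor Cvx fun_dist a f = (\<lambda>x. f x \<ominus> a)"
    unfolding cotensor_def using cot is_cotensor_unique[OF uniq cot] by (rule the_equality)
  then show "cotensor Cvx fun_dist a f x = f x \<ominus> a"
    by simp
  note ten = is_tensor_Cvx[of a f]
  show "\<exists>!p. is_tensor Cvx fun_dist a f p"
    using ten is_tensor_unique[OF uniq ten] by (rule ex1I)
  have "tensor Cvx fun_dist a f = biconjugate (\<lambda>z. f z + a)"
    unfolding tensor_def using ten is_tensor_unique[OF uniq ten] by (rule the_equality)
  then show ten_eq: "tensor Cvx fun_dist a f x = biconjugate (\<lambda>z. f z + a) x"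
    by simp
  assume "a \<noteq> -\<infinity> \<or> f x \<noteq> \<infinity> \<or> (\<forall>y. f y = \<infinity>)"
  then show "tensor Cvx fun_dist a f x = f x + a"
    unfolding ten_eq by (rule biconjugate_add_const[OF f])
qed

end
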